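(* For all nonnegative integers $k,n$, $a_{k,n}$ equals the number of pairs $(c_1,c_2)$, where $c_1$ is an ordered composition of $k+1$ into odd summands and $c_2$ is an ordered composition of $n+1$ into odd summands, such that $c_1$ and $c_2$ have the same number of summands.
   Context: For nonnegative integers $k,n$, let $a_{k,n}$ be the number of ways to partition a set consisting of $k$ marked points on a line and $n$ marked points on a parallel line into pairs, joining the two points of each pair by a straight segment, such that no two segments have a common point (in particular, no endpoint lies on another segment). We have $a_{0,0}=1$. A composition of $m$ is a representation of $m$ as an ordered sum of positive integers. Sums differing in the order of the summands are considered different. *)

theory Defs
  imports "HOL-Analysis.Analysis" "HOL-Library.Disjoint_Sets"
begin

definition pairing_on :: "'a set \<Rightarrow> 'a set set \<Rightarrow> bool" where
  "pairing_on P M \<longleftrightarrow> partition_on P M \<and> (\<forall>e\<in>M. card e = 2)"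

definition noncrossing :: "(real ^ 2) set set \<Rightarrow> bool" where
  "noncrossing M \<longleftrightarrow>
     (\<forall>p q r s. {p, q} \<in> M \<longrightarrow> {r, s} \<in> M \<longrightarrow> {p, q} \<noteq> {r, s} \<longrightarrow>
        closed_segment p q \<inter> closed_segment r s = {})"

text \<open>
  The two lines are kept as parameters and the marked points are arbitrary points on them:
  that the number of pairings depends only on the numbers of marked points is not built in.
  \<open>affine_parallel\<close> also relates a line to itself, hence \<open>L \<noteq> L'\<close>.
\<close>

definition marked_points ::
    "nat \<Rightarrow> nat \<Rightarrow> (real ^ 2) set \<Rightarrow> (real ^ 2) set \<Rightarrow> (real ^ 2) set \<Rightarrow> (real ^ 2) set \<Rightarrow> bool" where
  "marked_points k n L L' A B \<longleftrightarrow>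
     affine L \<and> aff_dim L = 1 \<and> affine_parallel L L' \<and> L \<noteq> L' \<and>
     A \<subseteq> L \<and> finite A \<and> card A = k \<and>
     B \<subseteq> L' \<and> finite B \<and> card B = n"

definition num_pairings :: "(real ^ 2) set \<Rightarrow> (real ^ 2) set \<Rightarrow> nat" where
  "num_pairings A B = card {M. pairing_on (A \<union> B) M \<and> noncrossing M}"

definition composition :: "nat \<Rightarrow> nat list \<Rightarrow> bool" where
  "composition m c \<longleftrightarrow> (\<forall>x\<in>set c. 0 < x) \<and> sum_list c = m"

end

theory Submission
  imports Defs
begin

text \<open>
  Both sides satisfy
  \<open>a(k, n) + a(k - 2, n - 2) = a(k - 2, n) + a(k, n - 2) + a(k - 1, n - 1)\<close> for
  \<open>(k, n) \<noteq> (0, 0)\<close>, where terms with a negative index vanish, and \<open>a(0, 0) = 1\<close>.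
  Let \<open>x' < x\<close> and \<open>y' < y\<close> be the last two points on either line. A noncrossing pairing contains
  \<open>{x, x'}\<close>, \<open>{y, y'}\<close> (possibly both) or \<open>{x, y}\<close>. Each of these edges is separated from all other
  points by a straight line, so it can be removed or added freely. For pairs of odd compositions
  the three cases are: the first summand of \<open>c1\<close> is at least 3, that of \<open>c2\<close> is, or both are 1.
\<close>

section \<open>Pairs of odd compositions\<close>

definition odd_comps :: "nat \<Rightarrow> nat list set" where
  "odd_comps m = {c. composition m c \<and> (\<forall>x\<in>set c. odd x)}"

definition comp_pairs :: "nat \<Rightarrow> nat \<Rightarrow> (nat list \<times> nat list) set" where
  "comp_pairs k n = {(c1, c2). c1 \<in> odd_comps (k + 1) \<and> c2 \<in> odd_comps (n + 1) \<and>
     length c1 = length c2}"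

text \<open>Adding 2 keeps the parity of the first summand and, on nonempty lists, the number of
  summands. This undoes the lowering of a first summand of at least 3.\<close>

definition bump :: "nat list \<Rightarrow> nat list" where
  "bump c = (hd c + 2) # tl c"

lemma length_le_sum_list_pos: "(\<forall>x\<in>set c. 0 < x) \<Longrightarrow> length c \<le> sum_list c" for c :: "nat list"
  by (induction c) force+

lemma finite_odd_comps: "finite (odd_comps m)"
proof (rule finite_subset)
  show "odd_comps m \<subseteq> {c. set c \<subseteq> {..m} \<and> length c \<le> m}"
    using length_le_sum_list_pos by (force simp: odd_comps_def composition_def member_le_sum_list)
qed (simp add: finite_lists_length_le)

lemma finite_comp_pairs: "finite (comp_pairs k n)"
  by (rule finite_subset[of _ "odd_comps (k + 1) \<times> odd_comps (n + 1)"])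
    (auto simp: comp_pairs_def finite_odd_comps)

lemma odd_comps_Suc_nonempty: "c \<in> odd_comps (Suc m) \<Longrightarrow> c \<noteq> []"
  by (auto simp: odd_comps_def composition_def)

lemma length_bump: "c \<in> odd_comps (Suc m) \<Longrightarrow> length (bump c) = length c"
  using odd_comps_Suc_nonempty by (fastforce simp: bump_def)

lemma inj_on_bump: "inj_on bump (odd_comps (Suc m))"
  by (auto simp: inj_on_def bump_def dest!: odd_comps_Suc_nonempty intro: list.expand)

text \<open>An odd first summand other than 1 is at least 3, so subtracting 2 leaves a positive odd
  number. Writing the sum as \<open>Suc m\<close> keeps all lists nonempty, and the guard
  \<open>2 \<le> m\<close> keeps the truncated subtraction exact.\<close>

lemma odd_comps_hd_not_1:
  "{c \<in> odd_comps (Suc m). hd c \<noteq> 1} = (if 2 \<le> m then bump ` odd_comps (Suc (m - 2)) else {})"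
    (is "?S = ?T")
proof (intro equalityI subsetI)
  fix c assume c: "c \<in> ?S"
  then obtain a r where [simp]: "c = a # r"
    using odd_comps_Suc_nonempty by (metis (lifting) list.exhaust mem_Collect_eq)
  have a: "odd a" "a \<noteq> 1" "a + sum_list r = Suc m"
    using c by (auto simp: odd_comps_def composition_def)
  then have a3: "3 \<le> a" by presburger
  have "odd (a - 2)" "0 < a - 2" using a a3 by auto
  then have "(a - 2) # r \<in> odd_comps (Suc (m - 2))" "2 \<le> m"
    using c a a3 by (auto simp: odd_comps_def composition_def)
  moreover have "bump ((a - 2) # r) = c" using a3 by (simp add: bump_def)
  ultimately show "c \<in> ?T" by (metis imageI)
next
  fix c assume "c \<in> ?T"
  then obtain b where m: "2 \<le> m" and b: "b \<in> odd_comps (Suc (m - 2))" and c: "c = bump b"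
    by (auto split: if_splits)
  obtain a r where "b = a # r" using odd_comps_Suc_nonempty[OF b] by (cases b) auto
  with b c m show "c \<in> ?S" by (auto simp: odd_comps_def composition_def bump_def)
qed

lemma odd_comps_hd_1: "{c \<in> odd_comps (Suc m). hd c = 1} = Cons 1 ` odd_comps m" (is "?S = ?T")
proof (intro equalityI subsetI)
  fix c assume c: "c \<in> ?S"
  then have "c \<noteq> []" using odd_comps_Suc_nonempty by blast
  then obtain r where "c = 1 # r" using c by (cases c) auto
  with c show "c \<in> ?T" by (auto simp: odd_comps_def composition_def)
qed (auto simp: odd_comps_def composition_def)

section \<open>The recursion for pairs of odd compositions\<close>

text \<open>Inclusion-exclusion where only \<open>P\<close> and \<open>Q\<close> may overlap, in
  additive form to avoid subtraction of naturals. It serves both recursions.\<close>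

lemma card_union_three:
  assumes "finite N" and "N = P \<union> Q \<union> R" and "R \<inter> P = {}" and "R \<inter> Q = {}"
  shows "card N + card (P \<inter> Q) = card P + card Q + card R"
proof -
  have "finite P" "finite Q" "finite R" using assms by auto
  then have "card N = card (P \<union> Q) + card R"
    using assms by (metis card_Un_disjoint finite_UnI Int_Un_distrib2 Int_commute sup_bot.right_neutral)
  with card_Un_Int[OF \<open>finite P\<close> \<open>finite Q\<close>] show ?thesis by simp
qed

text \<open>The pairs are sorted by their first summands; \<open>P\<close> and \<open>Q\<close>
  overlap where neither is 1. The case \<open>k = n = 0\<close> has to be excluded: removing both
  summands of \<open>([1], [1])\<close> leaves two empty lists, which no term on the right
  counts.\<close>

lemma card_comp_pairs_rec:
  assumes "0 < k + n"
  shows "card (comp_pairs k n)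
       + (if 2 \<le> k \<and> 2 \<le> n then card (comp_pairs (k - 2) (n - 2)) else 0) =
      (if 2 \<le> k then card (comp_pairs (k - 2) n) else 0)
    + (if 2 \<le> n then card (comp_pairs k (n - 2)) else 0)
    + (if 1 \<le> k \<and> 1 \<le> n then card (comp_pairs (k - 1) (n - 1)) else 0)"
proof -
  define P where "P = {c \<in> comp_pairs k n. hd (fst c) \<noteq> 1}"
  define Q where "Q = {c \<in> comp_pairs k n. hd (snd c) \<noteq> 1}"
  define R where "R = {c \<in> comp_pairs k n. hd (fst c) = 1 \<and> hd (snd c) = 1}"
  have mem1: "c \<in> odd_comps (Suc m) \<and> hd c \<noteq> 1 \<longleftrightarrow> 2 \<le> m \<and> c \<in> bump ` odd_comps (Suc (m - 2))" for c m
    using odd_comps_hd_not_1[of m] by (auto split: if_splits)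
  have mem2: "c \<in> odd_comps (Suc m) \<and> hd c = 1 \<longleftrightarrow> c \<in> Cons 1 ` odd_comps m" for c m
    using odd_comps_hd_1[of m] by auto
  have bump_back: "b \<in> odd_comps (Suc (m - 2)) \<Longrightarrow> 2 \<le> m \<Longrightarrow> bump b \<in> odd_comps (Suc m) \<and> hd (bump b) \<noteq> 1" for b m
    using mem1 by blast
  have P: "P = (if 2 \<le> k then map_prod bump id ` comp_pairs (k - 2) n else {})"
  proof (intro equalityI subsetI)
    fix c assume "c \<in> P"
    then obtain c1 c2 where c: "c = (c1, c2)" "c1 \<in> odd_comps (Suc k)" "hd c1 \<noteq> 1"
      "c2 \<in> odd_comps (Suc n)" "length c1 = length c2" by (auto simp: P_def comp_pairs_def)
    then obtain b where "2 \<le> k" "b \<in> odd_comps (Suc (k - 2))" "c1 = bump b" using mem1 by blast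
    with c show "c \<in> (if 2 \<le> k then map_prod bump id ` comp_pairs (k - 2) n else {})"
      by (auto simp: comp_pairs_def length_bump intro!: image_eqI[of _ _ "(b, c2)"])
  qed (auto simp: P_def comp_pairs_def length_bump dest: bump_back split: if_splits)
  have Q: "Q = (if 2 \<le> n then map_prod id bump ` comp_pairs k (n - 2) else {})"
  proof (intro equalityI subsetI)
    fix c assume "c \<in> Q"
    then obtain c1 c2 where c: "c = (c1, c2)" "c1 \<in> odd_comps (Suc k)" "hd c2 \<noteq> 1"
      "c2 \<in> odd_comps (Suc n)" "length c1 = length c2" by (auto simp: Q_def comp_pairs_def)
    then obtain b where "2 \<le> n" "b \<in> odd_comps (Suc (n - 2))" "c2 = bump b" using mem1 by blast
    with c show "c \<in> (if 2 \<le> n then map_prod id bump ` comp_pairs k (n - 2) else {})"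
      by (auto simp: comp_pairs_def length_bump intro!: image_eqI[of _ _ "(c1, b)"])
  qed (auto simp: Q_def comp_pairs_def length_bump dest: bump_back split: if_splits)
  have PQ: "P \<inter> Q = (if 2 \<le> k \<and> 2 \<le> n then map_prod bump bump ` comp_pairs (k - 2) (n - 2) else {})"
  proof (intro equalityI subsetI)
    fix c assume "c \<in> P \<inter> Q"
    then obtain c1 c2 where c: "c = (c1, c2)" "c1 \<in> odd_comps (Suc k)" "hd c1 \<noteq> 1" "hd c2 \<noteq> 1"
      "c2 \<in> odd_comps (Suc n)" "length c1 = length c2" by (auto simp: P_def Q_def comp_pairs_def)
    then obtain b1 b2 where "2 \<le> k" "b1 \<in> odd_comps (Suc (k - 2))" "c1 = bump b1"
      "2 \<le> n" "b2 \<in> odd_comps (Suc (n - 2))" "c2 = bump b2"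
      using mem1[of c1 k] mem1[of c2 n] by blast
    with c show "c \<in> (if 2 \<le> k \<and> 2 \<le> n then map_prod bump bump ` comp_pairs (k - 2) (n - 2) else {})"
      by (auto simp: comp_pairs_def length_bump intro!: image_eqI[of _ _ "(b1, b2)"])
  qed (auto simp: P_def Q_def comp_pairs_def length_bump dest: bump_back split: if_splits)
  have R: "R = (if 1 \<le> k \<and> 1 \<le> n then map_prod (Cons 1) (Cons 1) ` comp_pairs (k - 1) (n - 1) else {})"
  proof (intro equalityI subsetI)
    fix c assume "c \<in> R"
    then obtain c1 c2 where c: "c = (c1, c2)" "c1 \<in> odd_comps (Suc k)" "hd c1 = 1" "hd c2 = 1"
      "c2 \<in> odd_comps (Suc n)" "length c1 = length c2" by (auto simp: R_def comp_pairs_def)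
    then obtain b1 b2 where b: "b1 \<in> odd_comps k" "c1 = 1 # b1" "b2 \<in> odd_comps n" "c2 = 1 # b2"
      using mem2 by (metis (no_types, lifting) imageE)
    \<comment> \<open>If one index is 0, the corresponding rest is empty; equal lengths empty the
      other rest as well, so both indices are 0, against the assumption.\<close>
    have "k \<noteq> 0 \<and> n \<noteq> 0"
    proof (rule ccontr)
      assume "\<not> (k \<noteq> 0 \<and> n \<noteq> 0)"
      moreover have "c = []" if "c \<in> odd_comps 0" for c
        using that by (cases c) (auto simp: odd_comps_def composition_def)
      ultimately have "b1 = [] \<or> b2 = []" using b by auto
      then have "b1 = []" "b2 = []" using b c by auto
      with b assms show False by (auto simp: odd_comps_def composition_def)
    qed
    with b c show "c \<in> (if 1 \<le> k \<and> 1 \<le> n then map_prod (Cons 1) (Cons 1) ` comp_pairs (k - 1) (n - 1) else {})"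
      by (auto simp: comp_pairs_def intro!: image_eqI[of _ _ "(b1, b2)"])
  qed (use mem2 in \<open>auto simp: R_def comp_pairs_def split: if_splits\<close>)
  have inj: "inj_on (map_prod bump bump) (comp_pairs (k - 2) (n - 2))"
    "inj_on (map_prod bump id) (comp_pairs (k - 2) n)"
    "inj_on (map_prod id bump) (comp_pairs k (n - 2))"
    "inj_on (map_prod (Cons (1::nat)) (Cons (1::nat))) (comp_pairs (k - 1) (n - 1))"
    using inj_on_bump by (auto simp: inj_on_def comp_pairs_def)
  have "card (comp_pairs k n) + card (P \<inter> Q) = card P + card Q + card R"
    by (rule card_union_three[OF finite_comp_pairs]) (auto simp: P_def Q_def R_def)
  then show ?thesis
    unfolding PQ unfolding P Q R by (simp add: card_image inj[unfolded One_nat_def] if_distrib[of card] cong: if_cong)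
qed

lemma odd_comps_1: "odd_comps (Suc 0) = {[1]}"
proof -
  have "c = [1]" if "c \<in> odd_comps (Suc 0)" for c
  proof -
    have "length c \<le> 1" using that length_le_sum_list_pos[of c]
      by (auto simp: odd_comps_def composition_def)
    with that show ?thesis
      by (cases c) (auto simp: odd_comps_def composition_def)
  qed
  then show ?thesis by (auto simp: odd_comps_def composition_def)
qed

lemma card_comp_pairs_0_0: "card (comp_pairs 0 0) = 1"
proof -
  have "comp_pairs 0 0 = {([1], [1])}" by (auto simp: comp_pairs_def odd_comps_1)
  then show ?thesis by simp
qed

section \<open>Removing a separated edge\<close>

definition pairings :: "(real ^ 2) set \<Rightarrow> (real ^ 2) set set set" where
  "pairings P = {M. pairing_on P M \<and> noncrossing M}"

lemma finite_pairings: "finite P \<Longrightarrow> finite (pairings P)"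
  by (rule finite_subset[of _ "Pow (Pow P)"])
    (auto simp: pairings_def pairing_on_def partition_on_def)

lemma pairings_empty: "pairings {} = {{}}"
  by (auto simp: pairings_def pairing_on_def noncrossing_def partition_on_empty)

lemma pairings_partner:
  assumes "M \<in> pairings P" and "p \<in> P"
  obtains q where "q \<in> P" "q \<noteq> p" "{p, q} \<in> M"
proof -
  obtain e where e: "e \<in> M" "p \<in> e"
    using assms by (auto simp: pairings_def pairing_on_def partition_on_def)
  then have "card e = 2" "e \<subseteq> P" using assms by (auto simp: pairings_def pairing_on_def partition_on_def)
  then obtain q where "e = {p, q}" "q \<noteq> p" using e by (auto simp: card_2_iff)
  with e \<open>e \<subseteq> P\<close> that show thesis by auto
qed

lemma pairings_unique:
  assumes "M \<in> pairings P" and "{p, q} \<in> M" and "{p, r} \<in> M"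
  shows "q = r"
proof -
  have "disjoint M" using assms by (simp add: pairings_def pairing_on_def partition_on_def)
  then have "{p, q} = {p, r}" using disjointD assms(2,3) by (metis disjoint_insert(1) insertI1)
  then show ?thesis by (auto simp: doubleton_eq_iff)
qed

lemma pairings_noncrossing:
  "\<lbrakk>M \<in> pairings P; {p, q} \<in> M; {r, s} \<in> M; z \<in> closed_segment p q; z \<in> closed_segment r s\<rbrakk>
    \<Longrightarrow> {p, q} = {r, s}"
  unfolding pairings_def noncrossing_def by blast

text \<open>A block of a partition of \<open>P - e\<close> is disjoint from \<open>e\<close>, so a
  nonempty \<open>e\<close> is never such a block and can be recovered by deletion.\<close>

lemma inj_on_insert_edge:
  assumes "e \<noteq> {}"
  shows "inj_on (insert e) (pairings (P - e))"
proof -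
  have "e \<notin> M" if "M \<in> pairings (P - e)" for M
    using that assms by (auto simp: pairings_def pairing_on_def partition_on_def)
  then show ?thesis by (metis inj_onI insert_ident)
qed

text \<open>All other edges of a pairing have both endpoints in \<open>P - {p, q}\<close>. Hence
  \<open>sep\<close> rules out every crossing with the added edge, whichever pairing of the
  remaining points is chosen.\<close>

lemma pairings_remove_edge:
  assumes "{p, q} \<subseteq> P" and "p \<noteq> q"
    and sep: "\<And>r s. r \<in> P - {p, q} \<Longrightarrow> s \<in> P - {p, q} \<Longrightarrow>
      closed_segment p q \<inter> closed_segment r s = {}"
  shows "{M \<in> pairings P. {p, q} \<in> M} = insert {p, q} ` pairings (P - {p, q})"
    (is "?S = ?T")
proof (intro equalityI subsetI)
  fix M assume "M \<in> ?S"
  then have M: "pairing_on P M" "noncrossing M" "{p, q} \<in> M" by (auto simp: pairings_def)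
  then have "disjoint M" by (simp add: pairing_on_def partition_on_def)
  then have "\<Union> (M - {{p, q}}) = P - {p, q}"
    using M by (fastforce simp: pairing_on_def partition_on_def disjoint_def)
  then have "pairing_on (P - {p, q}) (M - {{p, q}})"
    using M by (auto simp: pairing_on_def partition_on_def disjoint_def)
  moreover have "noncrossing (M - {{p, q}})" using M by (auto simp: noncrossing_def)
  ultimately have "M - {{p, q}} \<in> pairings (P - {p, q})" by (simp add: pairings_def)
  moreover have "M = insert {p, q} (M - {{p, q}})" using M by auto
  ultimately show "M \<in> ?T" by blast
next
  fix M assume "M \<in> ?T"
  then obtain M' where M: "M = insert {p, q} M'" "pairing_on (P - {p, q}) M'" "noncrossing M'"
    by (auto simp: pairings_def)
  have "pairing_on P M"
    using M assms(1,2) by (auto simp: pairing_on_def partition_on_def disjoint_def)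
  moreover have "noncrossing M"
    unfolding noncrossing_def
  proof (intro allI impI)
    fix a b c d assume ab: "{a, b} \<in> M" and cd: "{c, d} \<in> M" and ne: "{a, b} \<noteq> {c, d}"
    have in': "x \<in> P - {p, q} \<and> y \<in> P - {p, q}" if "{x, y} \<in> M'" for x y
      using that M(2) by (auto simp: pairing_on_def partition_on_def)
    \<comment> \<open>The definition of \<open>noncrossing\<close> ranges over ordered endpoints, so
      the edge may appear in either orientation.\<close>
    have seg: "closed_segment x y = closed_segment p q" if "{x, y} = {p, q}" for x y
      using that by (auto simp: doubleton_eq_iff closed_segment_commute)
    consider "{a, b} \<in> M'" "{c, d} \<in> M'" | "{a, b} = {p, q}" "{c, d} \<in> M'"
      | "{a, b} \<in> M'" "{c, d} = {p, q}"
      using ab cd ne M(1) by auto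
    then show "closed_segment a b \<inter> closed_segment c d = {}"
    proof cases
      case 1 then show ?thesis using M(3) ne by (auto simp: noncrossing_def)
    next
      case 2 then show ?thesis using in'[OF 2(2)] seg sep by metis
    next
      case 3 then show ?thesis using in'[OF 3(1)] seg sep by (metis Int_commute)
    qed
  qed
  ultimately show "M \<in> ?S" using M by (auto simp: pairings_def)
qed

lemma finite_sets_separate:
  fixes S T :: "real set"
  assumes "finite S" and "finite T" and "\<And>s t. s \<in> S \<Longrightarrow> t \<in> T \<Longrightarrow> s < t"
  obtains c where "\<And>s. s \<in> S \<Longrightarrow> s < c" and "\<And>t. t \<in> T \<Longrightarrow> c < t"
proof (cases "S = {} \<or> T = {}")
  case True
  then show thesis
  proof
    assume [simp]: "S = {}"
    \<comment> \<open>Inserting 0 makes the minimum meaningful even if \<open>T\<close> is empty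
      too.\<close>
    have "Min (insert 0 T) - 1 < t" if "t \<in> T" for t
      using that assms(2) by (smt (verit) Min_le finite_insert insertCI)
    then show thesis using that by auto
  next
    assume "T = {}"
    moreover have "s < Max (insert 0 S) + 1" if "s \<in> S" for s
      using that assms(1) by (smt (verit) Max_ge finite_insert insertCI)
    ultimately show thesis using that by auto
  qed
next
  case False
  then have "Max S < Min T" using assms by simp
  then obtain c where "Max S < c" "c < Min T" using dense by blast
  then have "\<forall>s\<in>S. s < c" "\<forall>t\<in>T. c < t" using assms False by auto
  then show thesis using that by blast
qed

section \<open>Two parallel lines\<close>

text \<open>The two lines are \<open>a + span {d}\<close> and its translate by \<open>v\<close>.
  Since the assumption does not mention \<open>a\<close>, the locale predicate is
  \<open>parallel_lines d v\<close>.\<close>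

locale parallel_lines =
  fixes a d v :: "real ^ 2"
  assumes indep: "s *\<^sub>R d + u *\<^sub>R v = 0 \<Longrightarrow> s = 0 \<and> u = 0"
begin

definition f :: "real \<Rightarrow> real ^ 2" where "f t = a + t *\<^sub>R d"
definition g :: "real \<Rightarrow> real ^ 2" where "g t = a + v + t *\<^sub>R d"

text \<open>Affine coordinates that also reach points off the two lines, as needed for segments
  between them and for half-planes.\<close>

definition pt :: "real \<Rightarrow> real \<Rightarrow> real ^ 2" where "pt t u = a + t *\<^sub>R d + u *\<^sub>R v"

lemma pt_eq_iff: "pt t u = pt t' u' \<longleftrightarrow> t = t' \<and> u = u'"
proof
  assume "pt t u = pt t' u'"
  then have "(t - t') *\<^sub>R d + (u - u') *\<^sub>R v = 0" by (simp add: pt_def algebra_simps)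
  from indep[OF this] show "t = t' \<and> u = u'" by simp
qed simp

lemma f_pt: "f t = pt t 0" and g_pt: "g t = pt t 1"
  by (simp_all add: f_def g_def pt_def)

lemma f_eq_iff [simp]: "f s = f t \<longleftrightarrow> s = t" and g_eq_iff [simp]: "g s = g t \<longleftrightarrow> s = t"
  and f_neq_g [simp]: "f s \<noteq> g t" and g_neq_f [simp]: "g t \<noteq> f s"
  by (simp_all add: f_pt g_pt pt_eq_iff)

lemma pt_convex_comb:
  "(1 - w) *\<^sub>R pt t u + w *\<^sub>R pt t' u' = pt ((1 - w) * t + w * t') ((1 - w) * u + w * u')"
  by (simp add: pt_def algebra_simps)

text \<open>The quantity \<open>t - u * c\<close> is affine in the coordinates, and strict bounds on
  it survive convex combinations.\<close>

lemma convex_pt_halfplanes: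
  "convex {pt t u | t u. t < \<alpha> + u * c}" "convex {pt t u | t u. \<alpha> + u * c < t}"
proof -
  have lt: "(1 - w) * t + w * t' < \<alpha> + ((1 - w) * u + w * u') * c"
    if "0 \<le> w" "w \<le> 1" "t < \<alpha> + u * c" "t' < \<alpha> + u' * c" for t t' u u' w \<alpha> c :: real
    using convex_bound_lt[of "t - u * c" \<alpha> "t' - u' * c" "1 - w" w] that by (simp add: algebra_simps)
  show "convex {pt t u | t u. t < \<alpha> + u * c}"
    unfolding convex_alt by (auto simp: pt_convex_comb pt_eq_iff intro: lt)
  \<comment> \<open>The reversed inequality is \<open>lt\<close> with \<open>t\<close>,
    \<open>t'\<close>, \<open>\<alpha>\<close> and \<open>c\<close> negated.\<close>
  have gt: "\<alpha> + ((1 - w) * u + w * u') * c < (1 - w) * t + w * t'"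
    if "0 \<le> w" "w \<le> 1" "\<alpha> + u * c < t" "\<alpha> + u' * c < t'" for t t' u u' w
    using lt[of w "- t" "- \<alpha>" u "- c" "- t'" u'] that by (simp add: algebra_simps)
  show "convex {pt t u | t u. \<alpha> + u * c < t}"
    unfolding convex_alt by (auto simp: pt_convex_comb pt_eq_iff intro: gt)
qed

text \<open>The line through \<open>f \<alpha>\<close> and \<open>g \<beta>\<close> separates the two segments.\<close>

lemma segments_separated:
  assumes fin: "finite X1" "finite X2" "finite Y1" "finite Y2"
    and X: "\<And>s t. s \<in> X1 \<Longrightarrow> t \<in> X2 \<Longrightarrow> s < t"
    and Y: "\<And>s t. s \<in> Y1 \<Longrightarrow> t \<in> Y2 \<Longrightarrow> s < t"
    and pq: "{p, q} \<subseteq> f ` X2 \<union> g ` Y2" and rs: "{r, s} \<subseteq> f ` X1 \<union> g ` Y1"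
  shows "closed_segment p q \<inter> closed_segment r s = {}"
proof -
  obtain \<alpha> where \<alpha>: "\<And>s. s \<in> X1 \<Longrightarrow> s < \<alpha>" "\<And>t. t \<in> X2 \<Longrightarrow> \<alpha> < t"
    using finite_sets_separate[of X1 X2] fin X by metis
  obtain \<beta> where \<beta>: "\<And>s. s \<in> Y1 \<Longrightarrow> s < \<beta>" "\<And>t. t \<in> Y2 \<Longrightarrow> \<beta> < t"
    using finite_sets_separate[of Y1 Y2] fin Y by metis
  define lo where "lo = {pt t u | t u. t < \<alpha> + u * (\<beta> - \<alpha>)}"
  define hi where "hi = {pt t u | t u. \<alpha> + u * (\<beta> - \<alpha>) < t}"
  have "f ` X1 \<union> g ` Y1 \<subseteq> lo" unfolding lo_def f_pt g_pt using \<alpha> \<beta> by fastforce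
  moreover have "f ` X2 \<union> g ` Y2 \<subseteq> hi" unfolding hi_def f_pt g_pt using \<alpha> \<beta> by fastforce
  ultimately have "p \<in> hi" "q \<in> hi" "r \<in> lo" "s \<in> lo" using pq rs by auto
  moreover have "convex lo" "convex hi" unfolding lo_def hi_def by (rule convex_pt_halfplanes)+
  ultimately have "closed_segment p q \<subseteq> hi" "closed_segment r s \<subseteq> lo"
    by (simp_all add: closed_segment_subset)
  moreover have "lo \<inter> hi = {}" by (auto simp: lo_def hi_def pt_eq_iff)
  ultimately show ?thesis by blast
qed

text \<open>The sets \<open>X2\<close> and \<open>Y2\<close> hold the parameters of the endpoints of
  the removed edge: the two largest on one line, or the largest on each. The second claim keeps
  track of another edge \<open>e'\<close>, which is needed when two top edges are removed in
  succession.\<close>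

lemma remove_top_edge:
  assumes fin: "finite X1" "finite X2" "finite Y1" "finite Y2"
    and X: "\<And>s t. s \<in> X1 \<Longrightarrow> t \<in> X2 \<Longrightarrow> s < t"
    and Y: "\<And>s t. s \<in> Y1 \<Longrightarrow> t \<in> Y2 \<Longrightarrow> s < t"
    and e: "f ` X2 \<union> g ` Y2 = {p, q}" "p \<noteq> q"
    and un: "X = X1 \<union> X2" "Y = Y1 \<union> Y2"
  shows "card {M \<in> pairings (f ` X \<union> g ` Y). {p, q} \<in> M} =
      card (pairings (f ` X1 \<union> g ` Y1))" (is ?thesis1)
    and "e' \<noteq> {p, q} \<Longrightarrow>
      card {M \<in> pairings (f ` X \<union> g ` Y). {p, q} \<in> M \<and> e' \<in> M} =
      card {M \<in> pairings (f ` X1 \<union> g ` Y1). e' \<in> M}" (is "_ \<Longrightarrow> ?thesis2")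
proof -
  let ?P = "f ` X \<union> g ` Y"
  have "X1 \<inter> X2 = {}" "Y1 \<inter> Y2 = {}" using X Y by blast+
  then have "?P - (f ` X2 \<union> g ` Y2) = f ` X1 \<union> g ` Y1" by (auto simp: un image_iff)
  then have rest: "?P - {p, q} = f ` X1 \<union> g ` Y1" by (simp only: e)
  have eq: "{M \<in> pairings ?P. {p, q} \<in> M} = insert {p, q} ` pairings (f ` X1 \<union> g ` Y1)"
    unfolding rest[symmetric]
  proof (rule pairings_remove_edge)
    show "{p, q} \<subseteq> ?P" using e(1) un by blast
    show "closed_segment p q \<inter> closed_segment r s = {}"
      if "r \<in> ?P - {p, q}" "s \<in> ?P - {p, q}" for r s
      using that unfolding rest by (intro segments_separated[OF fin X Y]) (auto simp: e)
  qed (rule e)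
  have inj: "inj_on (insert {p, q}) (pairings (f ` X1 \<union> g ` Y1))"
    using inj_on_insert_edge[of "{p, q}" ?P] rest by simp
  show ?thesis1 unfolding eq by (rule card_image[OF inj])
  assume "e' \<noteq> {p, q}"
  then have "{M \<in> pairings ?P. {p, q} \<in> M \<and> e' \<in> M} =
      insert {p, q} ` {M \<in> pairings (f ` X1 \<union> g ` Y1). e' \<in> M}"
    using eq by auto
  then show ?thesis2 by (simp add: card_image inj_on_subset[OF inj])
qed

text \<open>A marked point strictly inside an edge would also lie on its own edge. Leaving
  \<open>u\<close> free covers both lines at once.\<close>

lemma pairings_adjacent:
  assumes "M \<in> pairings P" and "{pt x u, pt z u} \<in> M" and "z < y" and "y < x"
  shows "pt y u \<notin> P"
proof
  assume "pt y u \<in> P"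
  with assms(1) obtain q where q: "{pt y u, q} \<in> M" using pairings_partner by metis
  \<comment> \<open>The solution of \<open>(1 - w) * x + w * z = y\<close>.\<close>
  define w where "w = (x - y) / (x - z)"
  have w: "0 \<le> w" "w \<le> 1" using assms by (auto simp: w_def)
  have "w * (x - z) = x - y" using assms by (simp add: w_def)
  then have "(1 - w) * x + w * z = y" by (simp add: algebra_simps)
  moreover have "(1 - w) * u + w * u = u" by (simp add: algebra_simps)
  ultimately have "pt y u = (1 - w) *\<^sub>R pt x u + w *\<^sub>R pt z u" by (simp add: pt_convex_comb)
  then have "pt y u \<in> closed_segment (pt x u) (pt z u)" using w by (auto simp: in_segment)
  then have "{pt x u, pt z u} = {pt y u, q}"
    using pairings_noncrossing[OF assms(1,2) q] by simp
  then have "pt y u \<in> {pt x u, pt z u}" by blast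
  with assms show False by (simp add: pt_eq_iff)
qed

text \<open>Points with equal weight on the two segments lie at the same height, so it suffices to
  make their first coordinates agree.\<close>

lemma crossing_segments:
  assumes "z < x" and "w < y"
  shows "closed_segment (f x) (g w) \<inter> closed_segment (f z) (g y) \<noteq> {}"
proof -
  \<comment> \<open>The difference of the first coordinates at height \<open>u\<close> is affine in
    \<open>u\<close>, positive at 0 and negative at 1; this is its zero.\<close>
  define u where "u = (x - z) / ((x - z) + (y - w))"
  have u: "0 \<le> u" "u \<le> 1" using assms by (auto simp: u_def)
  have "u * ((x - z) + (y - w)) = x - z" using assms by (simp add: u_def)
  then have "(1 - u) * x + u * w = (1 - u) * z + u * y" by (simp add: algebra_simps)
  then have "(1 - u) *\<^sub>R f x + u *\<^sub>R g w = (1 - u) *\<^sub>R f z + u *\<^sub>R g y"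
    by (simp add: f_pt g_pt pt_convex_comb)
  then have "(1 - u) *\<^sub>R f x + u *\<^sub>R g w \<in> closed_segment (f x) (g w) \<inter> closed_segment (f z) (g y)"
    using u by (auto simp: in_segment)
  then show ?thesis by blast
qed

section \<open>The recursion for noncrossing pairings\<close>

lemma top_two:
  fixes X :: "real set"
  assumes "finite X" and "2 \<le> card X"
  defines "x \<equiv> Max X" and "x' \<equiv> Max (X - {Max X})"
  shows "x \<in> X" "x' \<in> X" "x' < x" "\<And>s. s \<in> X - {x, x'} \<Longrightarrow> s < x'"
    "\<And>s. s \<in> X - {x, x'} \<Longrightarrow> s < x" "card (X - {x, x'}) = card X - 2"
proof -
  have "X \<noteq> {}" using assms by auto
  then show x: "x \<in> X" using assms by simp
  then have "card (X - {x}) = card X - 1" using assms by simp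
  then have "0 < card (X - {x})" using assms(2) by linarith
  then have "X - {x} \<noteq> {}" by (metis card.empty less_irrefl)
  then have "x' \<in> X - {x}" using Max_in[of "X - {x}"] assms(1) by (simp add: x'_def x_def)
  then show x': "x' \<in> X" and less: "x' < x" using assms by (auto simp: less_le)
  then show "card (X - {x, x'}) = card X - 2" using x x' assms(1) by (simp add: card_Diff_subset)
  fix s assume "s \<in> X - {x, x'}"
  then show "s < x'" using assms(1) by (auto simp: x'_def x_def less_le)
  with less show "s < x" by simp
qed

text \<open>If the partner of the top point on its own line were not the second largest point, that
  second largest point would lie inside the edge.\<close>

lemma pairings_top_neighbour:
  assumes M: "M \<in> pairings P" and X: "finite X" "(\<lambda>t. pt t u) ` X \<subseteq> P"
    and z: "z \<in> X" "z \<noteq> Max X" "{pt (Max X) u, pt z u} \<in> M"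
  shows "2 \<le> card X \<and> z = Max (X - {Max X})"
proof -
  have "{Max X, z} \<subseteq> X" using X z by (auto intro: Max_in)
  then have c: "2 \<le> card X" using card_mono[OF X(1), of "{Max X, z}"] z by simp
  note t = top_two[OF X(1) c]
  have "\<not> z < Max (X - {Max X})" using pairings_adjacent[OF M z(3)] t X(2) by blast
  with t(4)[of z] z c show ?thesis by auto
qed

text \<open>Without any of the three top edges, \<open>x\<close> would be joined to some
  \<open>w < y\<close> and \<open>y\<close> to some \<open>z < x\<close>, and these edges cross.
  \<open>R\<close> is disjoint from \<open>P\<close> and from \<open>Q\<close> because a point has
  only one partner. The cardinality guards discard the cases in which a \<open>Max\<close> is taken
  of an empty set.\<close>

lemma card_pairings_rec:
  assumes X: "finite X" and Y: "finite Y" and ne: "X \<union> Y \<noteq> {}"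
  defines "N \<equiv> \<lambda>X Y. card (pairings (f ` X \<union> g ` Y))"
    and "x \<equiv> Max X" and "y \<equiv> Max Y"
    and "x' \<equiv> Max (X - {Max X})" and "y' \<equiv> Max (Y - {Max Y})"
  shows "N X Y + (if 2 \<le> card X \<and> 2 \<le> card Y then N (X - {x, x'}) (Y - {y, y'}) else 0) =
      (if 2 \<le> card X then N (X - {x, x'}) Y else 0)
    + (if 2 \<le> card Y then N X (Y - {y, y'}) else 0)
    + (if 1 \<le> card X \<and> 1 \<le> card Y then N (X - {x}) (Y - {y}) else 0)"
proof -
  let ?P = "f ` X \<union> g ` Y"
  define P where "P = {M \<in> pairings ?P. 2 \<le> card X \<and> {f x, f x'} \<in> M}"
  define Q where "Q = {M \<in> pairings ?P. 2 \<le> card Y \<and> {g y, g y'} \<in> M}"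
  define R where "R = {M \<in> pairings ?P. X \<noteq> {} \<and> Y \<noteq> {} \<and> {f x, g y} \<in> M}"
  note tX = top_two[OF X, folded x_def x'_def] and tY = top_two[OF Y, folded y_def y'_def]
  have "M \<in> P \<union> Q \<union> R" if M: "M \<in> pairings ?P" for M
  proof (rule ccontr)
    assume not: "M \<notin> P \<union> Q \<union> R"
    \<comment> \<open>A partner on the same line would have to be \<open>x'\<close>, which would put
      \<open>M\<close> into \<open>P\<close>.\<close>
    have 1: "\<exists>w\<in>Y. {f x, g w} \<in> M" if "X \<noteq> {}"
    proof -
      have "f x \<in> ?P" using that X by (auto simp: x_def)
      then obtain q where q: "q \<in> ?P" "q \<noteq> f x" "{f x, q} \<in> M" using pairings_partner[OF M] by metis
      show ?thesis
      proof (cases "q \<in> f ` X")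
        case True
        then obtain z where z: "z \<in> X" "q = f z" by blast
        have "2 \<le> card X \<and> z = x'"
          unfolding x'_def
          by (rule pairings_top_neighbour[OF M X, of 0]) (use z q in \<open>auto simp: f_pt x_def\<close>)
        then have "M \<in> P" using q z M by (simp add: P_def)
        with not show ?thesis by blast
      qed (use q in blast)
    qed
    have 2: "\<exists>z\<in>X. {g y, f z} \<in> M" if "Y \<noteq> {}"
    proof -
      have "g y \<in> ?P" using that Y by (auto simp: y_def)
      then obtain q where q: "q \<in> ?P" "q \<noteq> g y" "{g y, q} \<in> M" using pairings_partner[OF M] by metis
      show ?thesis
      proof (cases "q \<in> g ` Y")
        case True
        then obtain z where z: "z \<in> Y" "q = g z" by blast
        have "2 \<le> card Y \<and> z = y'"
          unfolding y'_def
          by (rule pairings_top_neighbour[OF M Y, of 1]) (use z q in \<open>auto simp: g_pt y_def\<close>)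
        then have "M \<in> Q" using q z M by (simp add: Q_def)
        with not show ?thesis by blast
      qed (use q in blast)
    qed
    \<comment> \<open>Either line being nonempty yields a partner on the other, so neither is
      empty.\<close>
    have XY: "X \<noteq> {}" "Y \<noteq> {}" using 1 2 ne by blast+
    obtain w where w: "w \<in> Y" "{f x, g w} \<in> M" using 1 XY by blast
    obtain z where z: "z \<in> X" "{f z, g y} \<in> M" using 2 XY by (auto simp: insert_commute)
    have "{f x, g y} \<notin> M" using not M XY by (simp add: R_def)
    then have "w \<noteq> y" "z \<noteq> x" using w z by auto
    moreover have "w \<le> y" "z \<le> x" using w z X Y by (auto simp: x_def y_def)
    ultimately have "w < y" "z < x" by simp_all
    then obtain t where "t \<in> closed_segment (f x) (g w)" "t \<in> closed_segment (f z) (g y)"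
      using crossing_segments by blast
    then have "{f x, g w} = {f z, g y}" using pairings_noncrossing[OF M w(2) z(2)] by blast
    with \<open>w < y\<close> show False by (simp add: doubleton_eq_iff)
  qed
  then have "pairings ?P = P \<union> Q \<union> R" by (auto simp: P_def Q_def R_def)
  moreover have "R \<inter> P = {}"
    using pairings_unique[of _ ?P "f x" "g y" "f x'"] by (auto simp: P_def R_def)
  moreover have "R \<inter> Q = {}"
    using pairings_unique[of _ ?P "g y" "f x" "g y'"] by (auto simp: Q_def R_def insert_commute)
  ultimately have "N X Y + card (P \<inter> Q) = card P + card Q + card R"
    unfolding N_def using X Y by (intro card_union_three finite_pairings) auto
  moreover have "card P = (if 2 \<le> card X then N (X - {x, x'}) Y else 0)"
  proof (cases "2 \<le> card X")
    case True
    then have "card P = card {M \<in> pairings ?P. {f x, f x'} \<in> M}" by (simp add: P_def)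
    also have "\<dots> = N (X - {x, x'}) Y" unfolding N_def
      by (rule remove_top_edge(1)[of _ "{x, x'}" _ "{}"]) (use tX[OF True] X Y in auto)
    finally show ?thesis using True by simp
  qed (simp add: P_def)
  moreover have "card Q = (if 2 \<le> card Y then N X (Y - {y, y'}) else 0)"
  proof (cases "2 \<le> card Y")
    case True
    then have "card Q = card {M \<in> pairings ?P. {g y, g y'} \<in> M}" by (simp add: Q_def)
    also have "\<dots> = N X (Y - {y, y'})" unfolding N_def
      by (rule remove_top_edge(1)[of _ "{}" _ "{y, y'}"]) (use tY[OF True] X Y in auto)
    finally show ?thesis using True by simp
  qed (simp add: Q_def)
  moreover have "card R = (if 1 \<le> card X \<and> 1 \<le> card Y then N (X - {x}) (Y - {y}) else 0)"
  proof (cases "X \<noteq> {} \<and> Y \<noteq> {}")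
    case True
    then have mem: "x \<in> X" "y \<in> Y" using X Y by (auto simp: x_def y_def)
    have less: "s < x" if "s \<in> X - {x}" for s using that X by (auto simp: x_def less_le)
    have less': "s < y" if "s \<in> Y - {y}" for s using that Y by (auto simp: y_def less_le)
    have "card R = card {M \<in> pairings ?P. {f x, g y} \<in> M}" using True by (simp add: R_def)
    also have "\<dots> = N (X - {x}) (Y - {y})" unfolding N_def
      by (rule remove_top_edge(1)[of _ "{x}" _ "{y}"]) (use less less' mem X Y in auto)
    finally show ?thesis using True X Y by (simp add: Suc_le_eq card_gt_0_iff)
  qed (use X Y in \<open>auto simp: R_def Suc_le_eq card_gt_0_iff\<close>)
  moreover have "card (P \<inter> Q) =
      (if 2 \<le> card X \<and> 2 \<le> card Y then N (X - {x, x'}) (Y - {y, y'}) else 0)"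
  proof (cases "2 \<le> card X \<and> 2 \<le> card Y")
    case True
    have "card (P \<inter> Q) = card {M \<in> pairings ?P. {f x, f x'} \<in> M \<and> {g y, g y'} \<in> M}"
      using True by (intro arg_cong[of _ _ card]) (auto simp: P_def Q_def)
    \<comment> \<open>The edge on the first line goes first, while the condition on the other edge
      is carried along; the next step removes that edge.\<close>
    also have "\<dots> = card {M \<in> pairings (f ` (X - {x, x'}) \<union> g ` Y). {g y, g y'} \<in> M}"
      by (rule remove_top_edge(2)[of _ "{x, x'}" _ "{}"])
        (use tX[OF conjunct1[OF True]] X Y in \<open>auto simp: doubleton_eq_iff\<close>)
    also have "\<dots> = N (X - {x, x'}) (Y - {y, y'})" unfolding N_def
      by (rule remove_top_edge(1)[of _ "{}" _ "{y, y'}"]) (use tY[OF conjunct2[OF True]] X Y in auto)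
    finally show ?thesis using True by simp
  qed (auto simp: P_def Q_def)
  ultimately show ?thesis by simp
qed

text \<open>Strong induction on the total number of points with both sets arbitrary, since the
  recursion passes to subsets. Both counts obey the same recursion and equal 1 when there are no
  points.\<close>

lemma card_pairings_eq_comp_pairs:
  assumes "finite X" and "finite Y"
  shows "card (pairings (f ` X \<union> g ` Y)) = card (comp_pairs (card X) (card Y))"
  using assms
proof (induction "card X + card Y" arbitrary: X Y rule: less_induct)
  case less
  note X = \<open>finite X\<close> and Y = \<open>finite Y\<close>
  show ?case
  proof (cases "X \<union> Y = {}")
    case True
    then show ?thesis by (simp add: pairings_empty card_comp_pairs_0_0[unfolded One_nat_def])
  next
    case False
    note tX = top_two(6)[OF X] and tY = top_two(6)[OF Y]
    let ?X = "X - {Max X, Max (X - {Max X})}" and ?Y = "Y - {Max Y, Max (Y - {Max Y})}"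
    have pos: "0 < card X + card Y" using False X Y by (auto simp: card_gt_0_iff)
    have 1: "2 \<le> card X \<Longrightarrow> card (pairings (f ` ?X \<union> g ` Y)) = card (comp_pairs (card X - 2) (card Y))"
      using less.hyps[of ?X Y] tX X Y by simp
    have 2: "2 \<le> card Y \<Longrightarrow> card (pairings (f ` X \<union> g ` ?Y)) = card (comp_pairs (card X) (card Y - 2))"
      using less.hyps[of X ?Y] tY X Y by simp
    have 3: "2 \<le> card X \<Longrightarrow> 2 \<le> card Y \<Longrightarrow>
        card (pairings (f ` ?X \<union> g ` ?Y)) = card (comp_pairs (card X - 2) (card Y - 2))"
      using less.hyps[of ?X ?Y] tX tY X Y by simp
    have 4: "card (pairings (f ` (X - {Max X}) \<union> g ` (Y - {Max Y}))) =
        card (comp_pairs (card X - 1) (card Y - 1))" if "1 \<le> card X" "1 \<le> card Y"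
    proof -
      have "X \<noteq> {}" "Y \<noteq> {}" using that by auto
      then show ?thesis
        using less.hyps[of "X - {Max X}" "Y - {Max Y}"] X Y that by simp
    qed
    show ?thesis
      using card_pairings_rec[OF X Y False] card_comp_pairs_rec[OF pos]
      \<comment> \<open>The congruence rule supplies each guard as the premise for rewriting its
        branch; afterwards the two recursions differ only in their leading terms.\<close>
      by (simp only: 1 2 3 4 cong: if_cong)
  qed
qed

end

section \<open>Coordinates for the given lines\<close>

text \<open>The direction space \<open>S\<close> of \<open>L\<close> is spanned by one vector
  \<open>d\<close>, and \<open>v\<close> is a translation taking \<open>L\<close> to
  \<open>L'\<close>. The lines being distinct forces \<open>v\<close> out of \<open>S\<close>, so
  \<open>d\<close> and \<open>v\<close> are independent.\<close>

lemma marked_points_coordinates: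
  assumes "marked_points k n L L' A B"
  obtains a d v where "parallel_lines d v"
    "A \<subseteq> range (parallel_lines.f a d)" "B \<subseteq> range (parallel_lines.g a d v)"
proof -
  have L: "affine L" "aff_dim L = 1" "affine_parallel L L'" "L \<noteq> L'" "A \<subseteq> L" "B \<subseteq> L'"
    using assms by (auto simp: marked_points_def)
  then have "L \<noteq> {}" by auto
  then obtain a where "a \<in> L" by blast
  define S where "S = (\<lambda>x. - a + x) ` L"
  have S: "subspace S" "L = (\<lambda>x. a + x) ` S"
    using affine_diffs_subspace[OF L(1) \<open>a \<in> L\<close>] by (auto simp: S_def image_image)
  then have "int (dim S) = 1"
    using aff_dim_translation_eq[of a S] L(2) aff_dim_subspace[OF S(1)] by simp
  then obtain D where D: "D \<subseteq> S" "independent D" "S = span D" "card D = 1"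
    using basis_exists[of S] S(1) by (metis of_nat_eq_1_iff span_minimal subset_antisym)
  then obtain d where d: "D = {d}" by (auto simp: card_1_singleton_iff)
  obtain v where v: "L' = (\<lambda>x. v + x) ` L" using L(3) by (auto simp: affine_parallel_def)
  have "d \<noteq> 0" using D d by auto
  \<comment> \<open>Translation by a vector of \<open>S\<close> would map \<open>L\<close> onto
    itself.\<close>
  have "v \<notin> S"
  proof
    assume "v \<in> S"
    then have "(\<lambda>x. v + x) ` S = S"
      using S(1) by (auto simp: image_iff subspace_add) (metis subspace_diff add.commute diff_add_cancel)
    then have "L' = L" unfolding v S(2) image_image by (metis (no_types, lifting) add.left_commute image_cong image_image)
    with L show False by simp
  qed
  have "parallel_lines d v"
  proof
    fix s u :: real assume eq: "s *\<^sub>R d + u *\<^sub>R v = 0"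
    have "u = 0"
    proof (rule ccontr)
      assume "u \<noteq> 0"
      have "u *\<^sub>R v = (- s) *\<^sub>R d" using eq by (simp add: eq_neg_iff_add_eq_0 add.commute)
      moreover have "v = (1 / u) *\<^sub>R (u *\<^sub>R v)" using \<open>u \<noteq> 0\<close> by simp
      ultimately have "v = (1 / u * - s) *\<^sub>R d" by (metis scaleR_scaleR)
      then have "v \<in> S" unfolding D(3) d by (metis insertI1 span_base span_scale)
      with \<open>v \<notin> S\<close> show False ..
    qed
    with eq \<open>d \<noteq> 0\<close> show "s = 0 \<and> u = 0" by simp
  qed
  moreover have "L \<subseteq> range (parallel_lines.f a d)"
    unfolding S(2) D(3) d span_singleton using parallel_lines.f_def[OF calculation] by auto
  moreover have "L' \<subseteq> range (parallel_lines.g a d v)"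
    unfolding v S(2) D(3) d span_singleton using parallel_lines.g_def[OF calculation(1)]
    by (auto simp: add_ac)
  ultimately show thesis using that L by blast
qed

theorem mainTheorem4:
  fixes k n :: nat and L L' A B :: "(real ^ 2) set"
  assumes "marked_points k n L L' A B"
  shows "num_pairings A B =
    card {(c1, c2). composition (k + 1) c1 \<and> (\<forall>x\<in>set c1. odd x) \<and>
                    composition (n + 1) c2 \<and> (\<forall>x\<in>set c2. odd x) \<and>
                    length c1 = length c2}"
proof -
  obtain a d v where pl: "parallel_lines d v" and
    sub: "A \<subseteq> range (parallel_lines.f a d)" "B \<subseteq> range (parallel_lines.g a d v)"
    using marked_points_coordinates[OF assms] .
  interpret parallel_lines a d v by (rule pl)
  \<comment> \<open>The marked points are replaced by their real parameters; injectivity of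
    \<open>f\<close> and \<open>g\<close> preserves the cardinalities \<open>k\<close> and
    \<open>n\<close>.\<close>
  obtain X Y where XY: "A = f ` X" "B = g ` Y" using sub by (meson subset_imageE)
  have inj: "inj_on f X" "inj_on g Y" by (auto simp: inj_on_def)
  have "finite X" "finite Y" "card X = k" "card Y = n"
    using assms inj by (auto simp: marked_points_def XY card_image dest: finite_imageD)
  then have "num_pairings A B = card (comp_pairs k n)"
    using card_pairings_eq_comp_pairs[of X Y] by (simp add: num_pairings_def pairings_def XY)
  also have "comp_pairs k n = {(c1, c2). composition (k + 1) c1 \<and> (\<forall>x\<in>set c1. odd x) \<and>
      composition (n + 1) c2 \<and> (\<forall>x\<in>set c2. odd x) \<and> length c1 = length c2}"
    by (auto simp: comp_pairs_def odd_comps_def)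
  finally show ?thesis .
qed

end
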